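(* Let $c$, $e$ and $m$ be integers with $m>1$, and let $d$ be a rational number such that $dm^2\in\mathbb{N}$, $dcm/e\in\mathbb{N}$, $c+dcm/e>0$ and $e+dm^2>0$. Let $$a=\frac{e-\sqrt{e^2+4e/c}}{2},\qquad b=\frac{e+\sqrt{e^2+4e/c}}{2}.$$ Then $$\left[0;\overline{c+\tfrac{dc}{e}m^{2n-1},\ e+dm^{2n}}\right]_{n=1}^{\infty}=\frac{e/c}{md+a}\cdot\frac{\displaystyle\sum_{n=0}^{\infty}\frac{(b/d)^n\,m^{-n(n+3)/2}}{(1/m;1/m)_n\,(-a/(dm^2);1/m)_n}}{\displaystyle\sum_{n=0}^{\infty}\frac{(b/d)^n\,m^{-n(n+1)/2}}{(1/m;1/m)_n\,(-a/(dm);1/m)_n}}.$$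
   Context: $\mathbb{N}$ denotes the positive integers. $[0;x_1,x_2,x_3,\dots]$ denotes the value (limit of convergents) of the continued fraction $\cfrac{1}{x_1+\cfrac{1}{x_2+\cfrac{1}{x_3+\cdots}}}$. The notation $[0;\overline{f_1(n),\dots,f_k(n)}]_{n=1}^\infty$ means that the partial quotients are the blocks $f_1(n),\dots,f_k(n)$ concatenated for $n=1,2,3,\dots$. Finally $(z;q)_0=1$ and $(z;q)_n=\prod_{k=0}^{n-1}(1-zq^k)$ for $n\ge1$. *)

theory Defs
  imports "HOL-Analysis.Analysis"
begin

(* Sequences of partial quotients are indexed from 1; the value at index 0 is irrelevant.
   convergent_of x n = [0; x 1, ..., x n], and convergent_of x 0 = [0;] = 0. *)
primrec convergent_of :: "(nat \<Rightarrow> real) \<Rightarrow> nat \<Rightarrow> real" where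
  "convergent_of x 0 = 0"
| "convergent_of x (Suc n) = 1 / (x 1 + convergent_of (\<lambda>i. x (Suc i)) n)"

definition has_cf_value :: "(nat \<Rightarrow> real) \<Rightarrow> real \<Rightarrow> bool" where
  "has_cf_value x v \<longleftrightarrow> convergent_of x \<longlonglongrightarrow> v"

(* For i \<ge> 1, blocks [f1, ..., fk] i is the i-th entry of the concatenation of the blocks
   f1 n, ..., fk n for n = 1, 2, 3, ... *)
definition blocks :: "(nat \<Rightarrow> real) list \<Rightarrow> nat \<Rightarrow> real" where
  "blocks fs i = (fs ! ((i - 1) mod length fs)) ((i - 1) div length fs + 1)"

definition q_pochhammer :: "real \<Rightarrow> real \<Rightarrow> nat \<Rightarrow> real" where
  "q_pochhammer z q n = (\<Prod>k<n. 1 - z * q ^ k)"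

end

theory Submission
  imports Defs
begin

text \<open>
  Put \<open>q = 1 / m\<close> and \<open>r = e / c\<close>, so that \<open>e = a + b\<close> and \<open>r = - a b\<close>. The continued fraction
  becomes \<open>r / (X\<^sub>1 + r / (X\<^sub>2 + \<dots>))\<close> with \<open>X\<^sub>k = a + b + d m\<^sup>k\<close>. For the series
  \<open>H(A, B) = \<Sum>n. B\<^sup>n q\<^bsup>n(n-1)/2\<^esup> / ((q;q)\<^sub>n (A;q)\<^sub>n)\<close> a comparison of terms gives a three-term
  relation between \<open>H(A, B)\<close>, \<open>H(A q, B q)\<close> and \<open>H(A q\<^sup>2, B q\<^sup>2)\<close>. At \<open>A = - a q\<^sup>k / d\<close> and
  \<open>B = b q\<^sup>k / d\<close> it says that suitably scaled ratios of consecutive values are positive tails of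
  the continued fraction. As the partial quotients are at least 1, positive tails determine the value.
\<close>

section \<open>Continued fractions with prescribed positive tails\<close>

text \<open>A single step u -> 1 / (y + u) with y >= 1 and u >= 0 need not contract uniformly, but
  two steps shrink distances by a factor of at least 4. All shifts \<open>k\<close> are treated at
  once, so that the induction can move on to the tail behind two entries.\<close>

lemma convergent_of_tendsto_tail:
  fixes x t :: "nat \<Rightarrow> real"
  assumes x: "\<And>k. x (Suc k) \<ge> 1" and t_pos: "\<And>k. t k > 0"
    and t_rec: "\<And>k. t k = 1 / (x (Suc k) + t (Suc k))"
  shows "convergent_of x \<longlonglongrightarrow> t 0"
proof -
  have nonneg: "convergent_of (\<lambda>i. x (i + k)) n \<ge> 0" for k n
  proof (induction n arbitrary: k)
    case (Suc n)
    have "convergent_of (\<lambda>i. x (i + Suc k)) n \<ge> 0" by (rule Suc)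
    then show ?case using x[of k] by simp
  qed simp
  have t_le: "t k \<le> 1" for k
    unfolding t_rec[of k] using x[of k] t_pos[of "Suc k"] by simp
  \<comment> \<open>The rate 1/2 is the square root of the two-step factor 1/4. The constant 2 makes
    the bound equal to 1 at n = 1, where both numbers lie between 0 and 1.\<close>
  have bound: "\<bar>convergent_of (\<lambda>i. x (i + k)) n - t k\<bar> \<le> 2 * (1 / 2) ^ n" for k n
  proof (induction n arbitrary: k rule: induct_nat_012)
    case 0
    then show ?case using t_le[of k] t_pos[of k] by simp
  next
    case 1
    have "1 / x (Suc k) \<le> 1" "1 / x (Suc k) > 0" using x[of k] by (auto simp: divide_simps)
    moreover have "convergent_of (\<lambda>i. x (i + k)) (Suc 0) = 1 / x (Suc k)" by simp
    moreover have "2 * (1 / 2 :: real) ^ Suc 0 = 1" by simp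
    ultimately show ?case using t_le[of k] t_pos[of k] by linarith
  next
    case (ge2 n)
    define w where "w = convergent_of (\<lambda>i. x (i + (k + 2))) n"
    define v where "v = t (k + 2)"
    define y where "y = x (Suc k)"
    define z where "z = x (Suc (Suc k))"
    have pos: "w \<ge> 0" "v > 0" "y \<ge> 1" "z \<ge> 1"
      unfolding w_def v_def y_def z_def by (rule nonneg t_pos x)+
    have P: "y * (z + u) + 1 \<ge> 2" if "u \<ge> 0" for u
      using mult_mono[of 1 y 1 "z + u"] pos that by simp
    have lhs: "convergent_of (\<lambda>i. x (i + k)) (Suc (Suc n)) = 1 / (y + 1 / (z + w))"
      by (simp add: w_def y_def z_def add.commute)
    have rhs: "t k = 1 / (y + 1 / (z + v))"
      unfolding t_rec[of k] t_rec[of "Suc k"] by (simp add: y_def z_def v_def)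
    have form: "1 / (y + 1 / (z + u)) = (z + u) / (y * (z + u) + 1)" if "u \<ge> 0" for u
    proof -
      have "z + u > 0" using that pos by simp
      then have "y + 1 / (z + u) = (y * (z + u) + 1) / (z + u)" by (simp add: field_simps)
      then show ?thesis by simp
    qed
    define p where "p = (y * (z + w) + 1) * (y * (z + v) + 1)"
    have p: "p \<ge> 4"
      unfolding p_def using mult_mono[OF P[of w] P[of v]] pos P[of w] by simp
    \<comment> \<open>In the cross-multiplied numerator the terms containing \<open>y\<close>
      cancel, which leaves exactly \<open>w - v\<close>.\<close>
    have "(z + w) / (y * (z + w) + 1) - (z + v) / (y * (z + v) + 1) = (w - v) / p"
      unfolding p_def using P[of w] P[of v] pos by (simp add: diff_frac_eq algebra_simps)
    then have "\<bar>convergent_of (\<lambda>i. x (i + k)) (Suc (Suc n)) - t k\<bar> = \<bar>w - v\<bar> / p"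
      using lhs rhs form[of w] form[of v] pos p by simp
    also have "\<dots> \<le> \<bar>w - v\<bar> / 4" using p by (intro divide_left_mono) auto
    also have "\<dots> \<le> 2 * (1 / 2) ^ n / 4"
      using ge2(1)[of "k + 2"] by (simp add: w_def v_def)
    finally show ?case by simp
  qed
  have "(\<lambda>n. 2 * (1 / 2 :: real) ^ n) \<longlonglongrightarrow> 2 * 0"
    by (intro tendsto_mult tendsto_const LIMSEQ_power_zero) simp
  then have "(\<lambda>n. 2 * (1 / 2 :: real) ^ n) \<longlonglongrightarrow> 0" by (simp only: mult_zero_right)
  moreover have "\<forall>\<^sub>F n in sequentially. norm (convergent_of x n - t 0) \<le> 2 * (1 / 2) ^ n"
    using bound[of 0] unfolding real_norm_def add_0_right by (rule always_eventually[OF allI])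
  ultimately have "(\<lambda>n. convergent_of x n - t 0) \<longlonglongrightarrow> 0"
    by (rule Lim_null_comparison[rotated])
  then show ?thesis by (rule LIM_zero_cancel)
qed

section \<open>The basic hypergeometric series and its three-term relation\<close>

text \<open>In standard notation this is the summand of 1phi1(0; A; q, -B); the negative argument
  absorbs the usual sign (-1)^n.\<close>

definition hyp_term :: "real \<Rightarrow> real \<Rightarrow> real \<Rightarrow> nat \<Rightarrow> real" where
  "hyp_term q A B n = B ^ n * q ^ (n choose 2) / (q_pochhammer q q n * q_pochhammer A q n)"

lemma q_pochhammer_0 [simp]: "q_pochhammer z q 0 = 1"
  by (simp add: q_pochhammer_def)

lemma q_pochhammer_Suc: "q_pochhammer z q (Suc n) = q_pochhammer z q n * (1 - z * q ^ n)"
  by (simp add: q_pochhammer_def)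

lemma q_pochhammer_Suc_shift: "q_pochhammer z q (Suc n) = (1 - z) * q_pochhammer (z * q) q n"
  unfolding q_pochhammer_def prod.lessThan_Suc_shift by (simp add: mult.assoc)

lemma mult_power_less_one:
  fixes q z :: real
  assumes "0 < q" "q < 1" "z < 1"
  shows "z * q ^ n < 1"
proof (cases "z \<le> 0")
  case True
  then have "z * q ^ n \<le> 0" using assms by (simp add: mult_nonpos_nonneg)
  then show ?thesis by simp
next
  case False
  have "z * q ^ n \<le> z * 1"
    using False assms by (intro mult_left_mono power_le_one) auto
  then show ?thesis using assms by simp
qed

lemma q_pochhammer_pos:
  assumes "0 < q" "q < 1" "z < 1"
  shows "q_pochhammer z q n > 0"
  unfolding q_pochhammer_def using mult_power_less_one[OF assms] by (intro prod_pos) simp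

lemma hyp_term_pos:
  assumes "0 < q" "q < 1" "A < 1" "B > 0"
  shows "hyp_term q A B n > 0"
  using assms by (simp add: hyp_term_def q_pochhammer_pos)

lemma choose_two_Suc: "Suc n choose 2 = (n choose 2) + n"
  by (simp add: numeral_2_eq_2)

lemma hyp_term_Suc:
  "hyp_term q A B (Suc n) = B * q ^ n / ((1 - q * q ^ n) * (1 - A * q ^ n)) * hyp_term q A B n"
  by (simp add: hyp_term_def q_pochhammer_Suc choose_two_Suc power_add mult_ac)

text \<open>The ratio of consecutive terms carries the factor \<open>q ^ n\<close> over a
  denominator tending to 1, so it tends to 0 for every \<open>B\<close>.\<close>

lemma summable_hyp_term:
  assumes q: "0 < q" "q < 1" and "A < 1"
  shows "summable (hyp_term q A B)"
proof -
  have "(\<lambda>n. q ^ n) \<longlonglongrightarrow> 0" using q by (intro LIMSEQ_power_zero) simp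
  then have "(\<lambda>n. B * q ^ n / ((1 - q * q ^ n) * (1 - A * q ^ n)))
      \<longlonglongrightarrow> B * 0 / ((1 - q * 0) * (1 - A * 0))"
    by (intro tendsto_intros) (use q in auto)
  then have "\<forall>\<^sub>F n in sequentially. \<bar>B * q ^ n / ((1 - q * q ^ n) * (1 - A * q ^ n))\<bar> < 1 / 2"
    by (auto dest: tendstoD[of _ _ _ "1 / 2"] simp: dist_real_def)
  then obtain N where
    N: "\<And>n. n \<ge> N \<Longrightarrow> \<bar>B * q ^ n / ((1 - q * q ^ n) * (1 - A * q ^ n))\<bar> < 1 / 2"
    by (auto simp: eventually_sequentially)
  show ?thesis
  proof (rule summable_ratio_test)
    show "norm (hyp_term q A B (Suc n)) \<le> 1 / 2 * norm (hyp_term q A B n)" if "n \<ge> N" for n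
      unfolding hyp_term_Suc real_norm_def abs_mult[of _ "hyp_term q A B n"]
      using N[OF that] by (intro mult_right_mono) auto
  qed simp
qed

lemma suminf_hyp_term_pos:
  assumes "0 < q" "q < 1" "A < 1" "B > 0"
  shows "suminf (hyp_term q A B) > 0"
  using assms by (intro suminf_pos summable_hyp_term hyp_term_pos)

text \<open>Both sides of the relation equal \<open>\<Sum>n. B\<^bsup>n+1\<^esup> q\<^bsup>n(n+1)/2\<^esup> / ((q;q)\<^sub>n (A q;q)\<^sub>n\<^sub>+\<^sub>1)\<close>
  once \<open>(1 - A) H(A q, B q)\<close> is subtracted; the left-hand one has vanishing term at index 0.\<close>

lemma hyp_three_term:
  assumes q: "0 < q" "q < 1" and A: "A < 1" "A * q < 1" "A * q ^ 2 < 1"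
  shows "(1 - A) * suminf (hyp_term q A B) =
    (1 - A + B) * suminf (hyp_term q (A * q) (B * q)) +
    A * B * q / (1 - A * q) * suminf (hyp_term q (A * q ^ 2) (B * q ^ 2))"
proof -
  let ?f = "hyp_term q A B" and ?g = "hyp_term q (A * q) (B * q)"
  let ?h = "hyp_term q (A * q ^ 2) (B * q ^ 2)"
  define P where "P = q_pochhammer q q"
  define Q where "Q = q_pochhammer (A * q) q"
  define T where "T n = B ^ Suc n * q ^ (n choose 2) * q ^ n / (P n * Q (Suc n))" for n
  have sf: "summable ?f" and sg: "summable ?g" and sh: "summable ?h"
    using q A by (auto intro: summable_hyp_term)
  have P: "P n \<noteq> 0" and Q: "Q n \<noteq> 0" for n
    using q_pochhammer_pos[of q q n] q_pochhammer_pos[of q "A * q" n] q A by (auto simp: P_def Q_def)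
  have P_Suc: "P (Suc n) = P n * (1 - q * q ^ n)" for n
    unfolding P_def by (rule q_pochhammer_Suc)
  have Q_Suc: "Q (Suc n) = Q n * (1 - A * q * q ^ n)" for n
    unfolding Q_def by (rule q_pochhammer_Suc)
  have qn: "1 - q * q ^ n \<noteq> 0" "1 - A * q * q ^ n \<noteq> 0" for n
    using mult_power_less_one[of q q n] mult_power_less_one[of q "A * q" n] q A by auto
  have left0: "(1 - A) * ?f 0 - (1 - A) * ?g 0 = 0"
    by (simp add: hyp_term_def)
  \<comment> \<open>The factor \<open>1 - A\<close> cancels the first factor of (A;q)_(n+1). Over a
    common denominator the numerators then combine by (1 - A q^(n+1)) - (1 - A) q^(n+1) = 1 -
    q^(n+1), which is the last factor of \<open>P (Suc n)\<close>.\<close>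
  have left: "(1 - A) * ?f (Suc n) - (1 - A) * ?g (Suc n) = T n" for n
  proof -
    define C where "C = B ^ Suc n * q ^ (n choose 2) * q ^ n"
    have "(1 - A) * ?f (Suc n) = C / (P (Suc n) * Q n)"
      using A unfolding hyp_term_def q_pochhammer_Suc_shift[of A] C_def
      by (simp add: choose_two_Suc power_add P_def Q_def)
    also have "\<dots> = C * (1 - A * q * q ^ n) / (P (Suc n) * Q (Suc n))"
      using qn unfolding Q_Suc by simp
    finally have 1: "(1 - A) * ?f (Suc n) = C * (1 - A * q * q ^ n) / (P (Suc n) * Q (Suc n))" .
    have 2: "(1 - A) * ?g (Suc n) = C * ((1 - A) * (q * q ^ n)) / (P (Suc n) * Q (Suc n))"
      unfolding hyp_term_def C_def
      by (simp add: choose_two_Suc power_add power_mult_distrib P_def Q_def)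
    have "(1 - A) * ?f (Suc n) - (1 - A) * ?g (Suc n)
        = C * (1 - q * q ^ n) / (P (Suc n) * Q (Suc n))"
      unfolding 1 2 diff_divide_distrib[symmetric] by (simp add: algebra_simps)
    also have "\<dots> = T n"
      using qn unfolding P_Suc T_def C_def by simp
    finally show ?thesis .
  qed
  \<comment> \<open>Over the denominator \<open>P n * Q (Suc n)\<close> the two numerators are 1 - A
    q^(n+1) and A q^(n+1) times \<open>C\<close>, and they add up to \<open>C\<close>.\<close>
  have right: "B * ?g n + A * B * q / (1 - A * q) * ?h n = T n" for n
  proof -
    define C where "C = B ^ Suc n * q ^ (n choose 2) * q ^ n"
    have "B * ?g n = C / (P n * Q n)"
      unfolding hyp_term_def C_def by (simp add: power_mult_distrib P_def Q_def)
    also have "\<dots> = C * (1 - A * q * q ^ n) / (P n * Q (Suc n))"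
      using qn unfolding Q_Suc by simp
    finally have 1: "B * ?g n = C * (1 - A * q * q ^ n) / (P n * Q (Suc n))" .
    have Q': "Q (Suc n) = (1 - A * q) * q_pochhammer (A * q ^ 2) q n"
      unfolding Q_def q_pochhammer_Suc_shift by (simp add: power2_eq_square mult.assoc)
    have 2: "A * B * q / (1 - A * q) * ?h n = C * (A * q * q ^ n) / (P n * Q (Suc n))"
      unfolding hyp_term_def Q' C_def
      by (simp add: power_mult_distrib P_def power2_eq_square mult_ac)
    show ?thesis
      unfolding 1 2 add_divide_distrib[symmetric] T_def C_def by (simp add: algebra_simps)
  qed
  have "(\<lambda>n. (1 - A) * ?f n - (1 - A) * ?g n) sums ((1 - A) * suminf ?f - (1 - A) * suminf ?g)"
    using sf sg by (intro sums_diff sums_mult summable_sums)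
  then have "(\<lambda>n. (1 - A) * ?f (Suc n) - (1 - A) * ?g (Suc n)) sums
      ((1 - A) * suminf ?f - (1 - A) * suminf ?g)"
    by (simp only: sums_Suc_iff[of "\<lambda>n. (1 - A) * ?f n - (1 - A) * ?g n"] left0 add_0_right)
  then have "T sums ((1 - A) * suminf ?f - (1 - A) * suminf ?g)"
    by (simp only: left)
  moreover have "T sums (B * suminf ?g + A * B * q / (1 - A * q) * suminf ?h)"
    using sums_add[OF sums_mult[OF summable_sums[OF sg], of B]
        sums_mult[OF summable_sums[OF sh], of "A * B * q / (1 - A * q)"]]
    by (simp only: right)
  ultimately have "(1 - A) * suminf ?f - (1 - A) * suminf ?g =
      B * suminf ?g + A * B * q / (1 - A * q) * suminf ?h"
    by (rule sums_unique2)
  then show ?thesis by (simp add: algebra_simps)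
qed

section \<open>Ratios of the series as tails of a continued fraction\<close>

text \<open>The tails with all numerators equal to \<open>r = - a b\<close>.\<close>

lemma hyp_ratio_recurrence:
  fixes a b d m q :: real and F R :: "nat \<Rightarrow> real"
  defines "F \<equiv> \<lambda>k. suminf (hyp_term q (- a / d * q ^ Suc k) (b / d * q ^ Suc k))"
    and "R \<equiv> \<lambda>k. F (Suc k) / (F k * (d * m ^ Suc k + a))"
  assumes m: "m > 1" "q = 1 / m" and d: "d > 0" and ab: "a < 0" "b > 0" and dma: "d * m + a > 0"
  shows "R k > 0" "R k = 1 / (a + b + d * m ^ Suc k - a * b * R (Suc k))"
proof -
  have q: "0 < q" "q < 1" using m by auto
  have dm: "d * m ^ Suc j + a > 0" for j
  proof -
    have "m ^ Suc j \<ge> m ^ 1" using m by (intro power_increasing) auto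
    then have "d * m ^ Suc j \<ge> d * m" using d by simp
    then show ?thesis using dma by simp
  qed
  \<comment> \<open>This is \<open>dm\<close> divided by \<open>d * m ^ Suc j\<close>; it keeps
    every factor of (A;q)_n positive.\<close>
  have less1: "- a / d * q ^ Suc j < 1" for j
  proof -
    have "- a / d * q ^ Suc j = - a / (d * m ^ Suc j)" using m by (simp add: power_divide)
    also have "\<dots> < 1" using dm[of j] d m by (subst divide_less_eq_1_pos) auto
    finally show ?thesis .
  qed
  have F: "F j > 0" for j
    unfolding F_def using q d ab less1[of j] by (intro suminf_hyp_term_pos) auto
  show R: "R k > 0" unfolding R_def using F dm by simp
  \<comment> \<open>In terms of \<open>w\<close> the parameters are A = -a/w and B = b/w, so
    multiplying the three-term relation by \<open>w\<close> clears the denominators of 1 - A and 1 -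
    A + B.\<close>
  define w where "w = d * m ^ Suc k"
  have w: "w > 0" using d m by (simp add: w_def)
  have Aw: "- a / d * q ^ Suc k = - a / w" "b / d * q ^ Suc k = b / w"
    unfolding w_def m(2) by (simp_all add: power_divide)
  have wa: "w + a > 0" "w * m + a > 0"
    using dm[of k] dm[of "Suc k"] by (simp_all add: w_def mult_ac)
  have l: "- a / w < 1" "- a / w * q < 1" "- a / w * q ^ 2 < 1"
    using less1[of k] less1[of "Suc k"] less1[of "Suc (Suc k)"] unfolding Aw(1)[symmetric]
    by (simp_all add: power2_eq_square mult_ac)
  have F0: "F k = suminf (hyp_term q (- a / w) (b / w))"
    unfolding F_def Aw ..
  have F1: "F (Suc k) = suminf (hyp_term q (- a / w * q) (b / w * q))"
    unfolding F_def Aw[symmetric] by (simp add: mult_ac)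
  have F2: "F (Suc (Suc k)) = suminf (hyp_term q (- a / w * q ^ 2) (b / w * q ^ 2))"
    unfolding F_def Aw[symmetric] by (simp add: power2_eq_square mult_ac)
  define X where "X = 1 - - a / w + b / w"
  define Y where "Y = - a / w * (b / w) * q / (1 - - a / w * q)"
  have rec: "(1 - - a / w) * F k = X * F (Suc k) + Y * F (Suc (Suc k))"
    unfolding F0 F1 F2 X_def Y_def by (rule hyp_three_term[OF q l])
  have wX: "w * (1 - - a / w) = w + a" "w * X = a + b + w"
    using w by (simp_all add: X_def field_simps)
  have "1 - - a / w * q = (w * m + a) / (w * m)" using w m by (simp add: field_simps)
  then have wY: "w * Y = - a * b / (w * m + a)"
    unfolding Y_def using w m by simp
  have "(w + a) * F k = w * ((1 - - a / w) * F k)"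
    unfolding wX[symmetric] by (simp only: mult.assoc)
  also have "\<dots> = (w * X) * F (Suc k) + (w * Y) * F (Suc (Suc k))"
    unfolding rec by (simp only: distrib_left mult.assoc)
  also have "\<dots> = (a + b + w) * F (Suc k) + - a * b / (w * m + a) * F (Suc (Suc k))"
    unfolding wX wY ..
  finally have main: "(w + a) * F k =
      (a + b + w) * F (Suc k) + - a * b / (w * m + a) * F (Suc (Suc k))" .
  have "R (Suc k) = F (Suc (Suc k)) / (F (Suc k) * (w * m + a))"
    by (simp add: R_def w_def mult_ac)
  then have R_F: "R (Suc k) * F (Suc k) = F (Suc (Suc k)) / (w * m + a)"
    using F[of "Suc k"] by simp
  \<comment> \<open>The factor \<open>d * m ^ Suc k + a\<close> in \<open>R\<close> was chosen for
    this: dividing \<open>main\<close> by \<open>F (Suc k)\<close> turns its left side into 1 /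
    \<open>R k\<close> and its last term into \<open>- a * b * R (Suc k)\<close>.\<close>
  have "(a + b + w - a * b * R (Suc k)) * F (Suc k) =
      (a + b + w) * F (Suc k) - a * b * (R (Suc k) * F (Suc k))"
    by (simp add: algebra_simps)
  also have "\<dots> = (w + a) * F k"
    unfolding main R_F by simp
  finally have "(a + b + w - a * b * R (Suc k)) * F (Suc k) = (w + a) * F k" .
  then have "a + b + w - a * b * R (Suc k) = (w + a) * F k / F (Suc k)"
    using F[of "Suc k"] by (simp add: field_simps)
  then show "R k = 1 / (a + b + d * m ^ Suc k - a * b * R (Suc k))"
    unfolding w_def[symmetric] by (simp add: R_def w_def mult_ac)
qed

section \<open>Indices, exponents and the position of the smaller root\<close>

lemma blocks_pair_Suc:
  "blocks [f, g] (Suc k) = (if even k then f (k div 2 + 1) else g (k div 2 + 1))"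
  by (simp add: blocks_def mod_2_eq_odd numeral_2_eq_2[symmetric])

text \<open>Since n(n+1)/2 = n + C(n,2) and n(n+3)/2 = 2n + C(n,2), the extra powers of 1/m can be
  absorbed into the argument \<open>B\<close> of \<open>hyp_term\<close>.\<close>

lemma powr_neg_eq_power_choose_two:
  fixes m :: real
  assumes "m > 0"
  shows "m powr (- (real n * (real n + 1) / 2)) = (1 / m) ^ n * (1 / m) ^ (n choose 2)"
    and "m powr (- (real n * (real n + 3) / 2)) = ((1 / m) ^ 2) ^ n * (1 / m) ^ (n choose 2)"
proof -
  have "real (n choose 2) = real n * (real n - 1) / 2"
    by (induction n) (simp_all add: choose_two_Suc field_simps)
  then have *: "real n * (real n + 1) / 2 = real (n + (n choose 2))"
    "real n * (real n + 3) / 2 = real (2 * n + (n choose 2))"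
    by (simp_all add: field_simps)
  show "m powr (- (real n * (real n + 1) / 2)) = (1 / m) ^ n * (1 / m) ^ (n choose 2)"
    unfolding * powr_minus powr_realpow[OF assms] power_add
    by (simp add: power_divide field_simps)
  show "m powr (- (real n * (real n + 3) / 2)) = ((1 / m) ^ 2) ^ n * (1 / m) ^ (n choose 2)"
    unfolding * powr_minus powr_realpow[OF assms] power_add power_mult
    by (simp add: power_divide field_simps)
qed

text \<open>With x = N r, the factor x + b is positive, so x + a has the sign of (x + a)(x + b) = r
  (N (N r + e) - 1). Integrality of \<open>c\<close>, \<open>e\<close> and \<open>N\<close> makes
  this product positive. The bound serves to show d m + a > 0.\<close>

lemma smaller_root_bound:
  fixes c e :: int and N :: nat and a b r :: real
  assumes ce: "c \<noteq> 0" "e \<noteq> 0" "r = of_int e / of_int c" "r > 0"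
    and ab: "a + b = of_int e" "a * b = - r" "b > 0"
    and N: "N > 0" "c + int N > 0"
  shows "real N * r + a > 0"
proof -
  define x where "x = real N * r"
  have x: "x > 0" using N ce(4) by (simp add: x_def)
  have "(x + a) * (x + b) = x ^ 2 + (a + b) * x + a * b"
    by (simp add: power2_eq_square algebra_simps)
  also have "\<dots> = r * (real N * (real N * r + of_int e) - 1)"
    unfolding ab x_def by (simp add: power2_eq_square algebra_simps)
  also have "\<dots> > 0"
  proof (cases "c > 0")
    case True
    then have "e > 0" using ce by (simp add: zero_less_divide_iff)
    then have "1 * 1 < real N * (real N * r + of_int e)"
      using N x unfolding x_def by (intro mult_le_less_imp_less add_pos_pos) auto
    then show ?thesis using ce(4) by simp
  next
    case False
    then have neg: "c < 0" "e < 0" using ce by (auto simp: zero_less_divide_iff)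
    \<comment> \<open>Here N (N r + e) = N r (N + c). The integer N + c is at least 1, and N r > -c
      r = -e >= 1.\<close>
    have er: "of_int e = r * of_int c" using ce by simp
    have "1 \<le> real_of_int (c + int N)" using N by linarith
    then have "real N * r * 1 \<le> real N * r * (real N + of_int c)"
      using x by (intro mult_left_mono) (auto simp: x_def)
    moreover have "real N * r > 1"
    proof -
      have "real N > - of_int c" using N by linarith
      then have "real N * r > - of_int c * r" using ce(4) mult_strict_right_mono by blast
      moreover have "- of_int c * r \<ge> 1" using neg er by (simp add: mult.commute)
      ultimately show ?thesis by linarith
    qed
    ultimately have "real N * r * (real N + of_int c) > 1" by linarith
    then have "real N * (real N * r + of_int e) > 1"
      unfolding er by (simp add: algebra_simps)
    then show ?thesis using ce(4) by simp
  qed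
  finally have "(x + a) * (x + b) > 0" .
  moreover have "x + b > 0" using x ab by simp
  ultimately show ?thesis unfolding x_def[symmetric] by (simp add: zero_less_mult_iff)
qed

section \<open>Equivalence transformation to the given partial quotients\<close>

theorem theorem2:
  fixes c e m :: int and d :: rat and a b :: real and num den :: "nat \<Rightarrow> real"
  assumes "m > 1"
    and "d * of_int m ^ 2 \<in> \<nat> - {0}"
    and "d * of_int c * of_int m / of_int e \<in> \<nat> - {0}"
    and "of_int c + d * of_int c * of_int m / of_int e > 0"
    and "of_int e + d * of_int m ^ 2 > 0"
    and "a = (of_int e - sqrt (of_int e ^ 2 + 4 * of_int e / of_int c)) / 2"
    and "b = (of_int e + sqrt (of_int e ^ 2 + 4 * of_int e / of_int c)) / 2"
    and "num = (\<lambda>n. (b / of_rat d) ^ n * of_int m powr (- (real n * (real n + 3) / 2)) /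
           (q_pochhammer (1 / of_int m) (1 / of_int m) n *
            q_pochhammer (- a / (of_rat d * of_int m ^ 2)) (1 / of_int m) n))"
    and "den = (\<lambda>n. (b / of_rat d) ^ n * of_int m powr (- (real n * (real n + 1) / 2)) /
           (q_pochhammer (1 / of_int m) (1 / of_int m) n *
            q_pochhammer (- a / (of_rat d * of_int m)) (1 / of_int m) n))"
  shows "summable num \<and> summable den \<and>
    has_cf_value
      (blocks [\<lambda>n. of_int c + of_rat d * of_int c / of_int e * of_int m ^ (2 * n - 1),
               \<lambda>n. of_int e + of_rat d * of_int m ^ (2 * n)])
      ((of_int e / of_int c) / (of_int m * of_rat d + a) * (suminf num / suminf den))"
proof -
  define M where "M = real_of_int m"
  define D where "D = (of_rat d :: real)"
  define r where "r = real_of_int e / of_int c"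
  define q where "q = 1 / M"
  have M: "M > 1" using assms(1) by (simp add: M_def)
  obtain N1 where N1: "d * of_int m ^ 2 = of_nat N1" "N1 > 0"
    using assms(2) by (metis DiffE Nats_cases gr0I insertI1 of_nat_0)
  obtain N2 where N2: "d * of_int c * of_int m / of_int e = of_nat N2" "N2 > 0"
    using assms(3) by (metis DiffE Nats_cases gr0I insertI1 of_nat_0)
  have ce: "c \<noteq> 0" "e \<noteq> 0" using N2 by auto
  \<comment> \<open>Positivity is moved from the rationals to the integers, where it means
    \<open>c + int N2\<close> is at least 1.\<close>
  have "(of_int (c + int N2) :: rat) > 0" using assms(4) unfolding N2 by simp
  then have cN: "c + int N2 > 0" by (simp only: of_int_0_less_iff)
  have "(of_int (e + int N1) :: rat) > 0" using assms(5) unfolding N1 by simp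
  then have eN: "e + int N1 > 0" by (simp only: of_int_0_less_iff)
  have DN1: "D * M ^ 2 = real N1"
    using arg_cong[OF N1(1), of "of_rat :: rat \<Rightarrow> real"]
    by (simp add: D_def M_def of_rat_mult of_rat_power)
  have DN2: "D * of_int c * M / of_int e = real N2"
    using arg_cong[OF N2(1), of "of_rat :: rat \<Rightarrow> real"]
    by (simp add: D_def M_def of_rat_mult of_rat_divide)
  have "D * M ^ 2 > 0" using DN1 N1 by simp
  then have D: "D > 0" using M by (simp add: zero_less_mult_iff)
  \<comment> \<open>This identity forces \<open>r\<close> to be positive. Hence the square root is
    real and exceeds the absolute value of \<open>e\<close>, which gives a < 0 < b.\<close>
  have DM: "D * M = real N2 * r" unfolding r_def DN2[symmetric] using ce by simp
  then have "real N2 * r > 0" using D M by (metis mult_pos_pos less_trans zero_less_one)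
  then have r: "r > 0" using N2 by (simp add: zero_less_mult_iff)
  define s where "s = sqrt (of_int e ^ 2 + 4 * r)"
  have s2: "s ^ 2 = of_int e ^ 2 + 4 * r" using r by (simp add: s_def)
  have s: "s > \<bar>of_int e\<bar>"
    unfolding s_def using r by (intro real_less_rsqrt) simp
  have a: "a = (of_int e - s) / 2" and b: "b = (of_int e + s) / 2"
    using assms(6,7) by (simp_all add: s_def r_def)
  have ab: "a < 0" "b > 0" "a + b = of_int e" using s by (auto simp: a b field_simps)
  have "a * b = (of_int e ^ 2 - s ^ 2) / 4"
    by (simp add: a b power2_eq_square field_simps)
  then have abr: "a * b = - r" using s2 by simp
  have dma: "D * M + a > 0"
    unfolding DM by (rule smaller_root_bound[OF ce r_def r ab(3) abr ab(2) N2(2) cN])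
  have q: "0 < q" "q < 1" using M by (auto simp: q_def)

  define F where "F k = suminf (hyp_term q (- a / D * q ^ Suc k) (b / D * q ^ Suc k))" for k
  define R where "R k = F (Suc k) / (F k * (D * M ^ Suc k + a))" for k
  \<comment> \<open>Scaling every other tail by \<open>r\<close> turns all numerators
    \<open>r\<close> into 1: for even \<open>k\<close> the denominator e + D M^(k+1) is divided by
    \<open>r\<close> = e/c and becomes the entry with leading term \<open>c\<close>.\<close>
  define t where "t k = (if even k then r else 1) * R k" for k
  define x where "x = blocks [\<lambda>n. of_int c + D * of_int c / of_int e * M ^ (2 * n - 1),
               \<lambda>n. of_int e + D * M ^ (2 * n)]"
  note R_rec = hyp_ratio_recurrence[OF M q_def D ab(1,2) dma, folded F_def, folded R_def]
  have R_rec': "R k = 1 / (of_int e + D * M ^ Suc k + r * R (Suc k))" for k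
    using R_rec(2)[of k] abr ab(3) by simp
  \<comment> \<open>For even \<open>k\<close> the block number is n = k/2 + 1, so 2n - 1 = k + 1;
    for odd \<open>k\<close> likewise 2n = k + 1.\<close>
  have x_even: "x (Suc k) = of_int c + D * of_int c / of_int e * M ^ Suc k" if "even k" for k
    using that by (auto simp: x_def blocks_pair_Suc elim!: evenE)
  have x_odd: "x (Suc k) = of_int e + D * M ^ Suc k" if "odd k" for k
    using that by (auto simp: x_def blocks_pair_Suc elim!: oddE)
  have "convergent_of x \<longlonglongrightarrow> t 0"
  proof (rule convergent_of_tendsto_tail)
    fix k
    show "t k > 0" using R_rec(1)[of k] r by (simp add: t_def)
    \<comment> \<open>Each entry is \<open>c\<close> or \<open>e\<close> plus a positive integer
      times a power of \<open>M\<close>, hence at least the positive integer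
      \<open>c + int N2\<close> or \<open>e + int N1\<close>.\<close>
    show "x (Suc k) \<ge> 1"
    proof (cases "even k")
      case True
      have "D * of_int c / of_int e * M ^ Suc k = real N2 * M ^ k"
        unfolding DN2[symmetric] by simp
      moreover have "real N2 * M ^ k \<ge> real N2 * 1"
        using M by (intro mult_left_mono one_le_power) auto
      ultimately show ?thesis using x_even[OF True] cN by linarith
    next
      case False
      then obtain j where j: "k = 2 * j + 1" by (elim oddE)
      have "D * M ^ Suc k = real N1 * M ^ (2 * j)"
        unfolding DN1[symmetric] by (simp add: j power2_eq_square)
      moreover have "real N1 * M ^ (2 * j) \<ge> real N1 * 1"
        using M by (intro mult_left_mono one_le_power) auto
      ultimately show ?thesis using x_odd[OF False] eN by linarith
    qed
    show "t k = 1 / (x (Suc k) + t (Suc k))"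
    proof (cases "even k")
      case True
      have "of_int e + D * M ^ Suc k + r * R (Suc k) = r * (x (Suc k) + R (Suc k))"
        unfolding x_even[OF True] using ce by (simp add: r_def field_simps)
      then show ?thesis using True r R_rec'[of k] by (simp add: t_def)
    next
      case False
      then show ?thesis using R_rec'[of k] by (simp add: t_def x_odd)
    qed
  qed
  \<comment> \<open>The numerator series is the one summed in \<open>F 1\<close> and the denominator
    series the one summed in \<open>F 0\<close>, so their quotient appears in
    \<open>R 0\<close>.\<close>
  moreover have num: "num = hyp_term q (- a / D * q ^ Suc 1) (b / D * q ^ Suc 1)"
  proof -
    have "- a / D * q ^ Suc 1 = - a / (D * M ^ 2)" "b / D * q ^ Suc 1 = b / D * (1 / M) ^ 2"
      by (simp_all add: q_def power2_eq_square)
    then show ?thesis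
      unfolding assms(8) hyp_term_def M_def[symmetric] D_def[symmetric]
      using powr_neg_eq_power_choose_two(2)[of M] M
      by (simp only: q_def power_mult_distrib mult.assoc)
  qed
  moreover have den: "den = hyp_term q (- a / D * q ^ Suc 0) (b / D * q ^ Suc 0)"
  proof -
    have "- a / D * q ^ Suc 0 = - a / (D * M)" "b / D * q ^ Suc 0 = b / D * (1 / M)"
      by (simp_all add: q_def)
    then show ?thesis
      unfolding assms(9) hyp_term_def M_def[symmetric] D_def[symmetric]
      using powr_neg_eq_power_choose_two(1)[of M] M
      by (simp only: q_def power_mult_distrib mult.assoc)
  qed
  moreover have "t 0 = r / (M * D + a) * (suminf num / suminf den)"
    unfolding num den F_def[symmetric] by (simp add: t_def R_def mult_ac)
  moreover have less1: "- a / D * q < 1"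
    using dma D M by (simp add: q_def divide_simps)
  moreover have "- a / D * q * q < 1"
    using mult_power_less_one[OF q less1, of 1] by simp
  ultimately show ?thesis
    using q summable_hyp_term[of q]
    unfolding has_cf_value_def x_def M_def[symmetric] D_def[symmetric] r_def[symmetric]
    by (simp add: mult_ac)
qed

end
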